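(* Let $d,k,q\in\mathbb{N}$ be positive integers. Let $\boldsymbol{x}\in\mathbb{R}^{4^d}$ with $\boldsymbol{x}\neq\boldsymbol{0}$ be such that $F_{\mathcal{B}}^{-1}(\boldsymbol{x})\in\mathcal{B}_k^{4^d}$. Let the integer $\beta$ with $0\le\beta\le q-2d+2$ be the fixed precision parameter. Let $\tilde{C}$ and $\tilde{D}$ be the lossy ZFP fixed precision compression and decompression operators (with block-floating-point precision $q$, floating-point precision $k$, and fixed precision parameter $\beta$) defined in the context. Then $$\|\tilde{D}\tilde{C}\boldsymbol{x}-\boldsymbol{x}\|_\infty\le K_\beta\|\boldsymbol{x}\|_\infty,$$ where $$K_\beta:=\left(\frac{15}{4}\right)^d\left((1+\epsilon_k)\left(\frac{8}{3}\epsilon_\beta+\epsilon_q\left(1+\frac{8}{3}\epsilon_\beta\right)\left(k_L(1+\epsilon_q)+1\right)\right)+\epsilon_k\right),\qquad k_L=\frac{7}{4}(2^d-1),$$ and $\epsilon_m=2^{1-m}$ for every integer $m$.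
   Context: **Bit spaces.** $\epsilon_m:=2^{1-m}$ for $m\in\mathbb{Z}$. $\mathcal{C}$ is the set of sequences $c=(c_i)_{i\in\mathbb{Z}}$ with $c_i\in\{0,1\}$, and $\mathcal{I}(c)=\{i:c_i=1\}$. For each $x\in\mathbb{R}$ fix one signed binary representation $x=(-1)^p\sum_i a_i2^i$ ($p\in\{0,1\}$, $a\in\mathcal{C}$) and one negabinary representation $x=\sum_i d_i(-2)^i$ ($d\in\mathcal{C}$), using representations with finitely many nonzero digits whenever they exist (and $p=0$ for $x=0$). $\mathcal{B}$ is the set of all chosen pairs $(p,a)$ and $\mathcal{N}$ the set of all chosen $d$; $f_{\mathcal{B}}:\mathcal{B}\to\mathbb{R}$, $f_{\mathcal{N}}:\mathcal{N}\to\mathbb{R}$ are the resulting bijections, and $F_{\mathcal{B}},F_{\mathcal{N}}$ their componentwise versions on $\mathcal{B}^n,\mathcal{N}^n$. For $b=(p,a)\in\mathcal{B}$ write $\mathcal{I}(b)=\mathcal{I}(a)$. $\mathcal{B}_k$ is the set of $b\in\mathcal{B}$ with $\mathcal{I}(b)\subseteq\{i,i+1,\dots,i+k-1\}$ for some $i\in\mathbb{Z}$. For nonzero $\boldsymbol{x}\in\mathbb{R}^n$, $e_{max}(\boldsymbol{x})=\max_{i}\max\mathcal{I}(f_{\mathcal{B}}^{-1}(\boldsymbol{x}_i))$. For $\mathcal{S}\subseteq\mathbb{Z}$ the truncation $t_{\mathcal{S}}$ sets all bits with index not in $\mathcal{S}$ to $0$; the shift $s_\ell$ is $s_\ell(c)_i=c_{i+\ell}$;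 on $\mathcal{B}$ both act on the bit sequence and keep the sign (a zero bit sequence is identified with zero); $T_{\mathcal{S}},S_\ell$ are the componentwise versions. **Linear transform.** $$L=\frac1{16}\begin{bmatrix}4&4&4&4\\5&1&-1&-5\\-4&4&4&-4\\-2&6&-6&2\end{bmatrix},\qquad L_d=L\otimes\cdots\otimes L\ (d\text{ factors}).$$ The lossy version $\tilde{L}:\mathbb{Z}^4\to\mathbb{Z}^4$ is the result of the following sequential assignments on $(a_1,a_2,a_3,a_4)$, where $r(a)=\lfloor a/2\rfloor$: $a_1\leftarrow a_1+a_4$; $a_1\leftarrow r(a_1)$; $a_4\leftarrow a_4-a_1$; $a_3\leftarrow a_3+a_2$; $a_3\leftarrow r(a_3)$; $a_2\leftarrow a_2-a_3$; $a_1\leftarrow a_1+a_3$; $a_1\leftarrow r(a_1)$; $a_3\leftarrow a_3-a_1$; $a_4\leftarrow a_4+a_2$; $a_4\leftarrow r(a_4)$; $a_2\leftarrow a_2-a_4$; $a_4\leftarrow a_4+r(a_2)$; $a_2\leftarrow a_2-r(a_4)$. The map $\tilde{L}_d:\mathbb{Z}^{4^d}\to\mathbb{Z}^{4^d}$ views its input as a $4\times\cdots\times4$ ($d$-dimensional) array and applies $\tilde{L}$ to every line in each of the $d$ coordinate directions, one direction after another. **ZFP operators.** Put $\ell=e_{max}(\boldsymbol{x})-q+1$, where $\boldsymbol{x}$ is the nonzero block being compressed. - $\tilde{C}_2(\boldsymbol{x})=T_{\mathcal{S}}S_\ell F_{\mathcal{B}}^{-1}(\boldsymbol{x})$ with $\mathcal{S}=\{i\ge0\}$.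 - $\tilde{C}_3=F_{\mathcal{B}}^{-1}\tilde{L}_dF_{\mathcal{B}}$; $D_3=F_{\mathcal{B}}^{-1}L_d^{-1}F_{\mathcal{B}}$. - $C_4$ is a fixed permutation of the $4^d$ components (total sequency order), $D_4=C_4^{-1}$. - $C_5=F_{\mathcal{N}}^{-1}F_{\mathcal{B}}$, $D_5=F_{\mathcal{B}}^{-1}F_{\mathcal{N}}$. - $\tilde{C}_8=T_{\mathcal{P}}$ on $\mathcal{N}^{4^d}$ with $\mathcal{P}=\{i\in\mathbb{Z}:i>q+1-\beta\}$. - $\tilde{D}_2(\boldsymbol{a})=F_{\mathcal{B}}S_{-\ell}\,fl_k(\boldsymbol{a})$, where $fl_k(\boldsymbol{a})_i$ is $\boldsymbol{a}_i$ truncated to the bits with index $j>\max\mathcal{I}(\boldsymbol{a}_i)-k$ (and $fl_k$ maps zero to zero). Then $\tilde{C}=\tilde{C}_8\circ C_5\circ C_4\circ\tilde{C}_3\circ\tilde{C}_2$ and $\tilde{D}=\tilde{D}_2\circ D_3\circ D_4\circ D_5$ (the decompression uses the value $\ell$ stored at compression). *)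

theory Defs
  imports
    "HOL-Analysis.Infinite_Sum"
    "HOL-Combinatorics.Permutations"
    "Jordan_Normal_Form.Gauss_Jordan_Elimination"
begin

text \<open>Vectors of arbitrary component type (reals, integers, bit sequences) are the vectors of
  \<^theory>\<open>Jordan_Normal_Form.Matrix\<close>, indexed from 0; componentwise application is \<^const>\<open>map_vec\<close>.\<close>

definition eps :: "int \<Rightarrow> real" where
  "eps m = 2 powi (1 - m)"

definition inf_norm :: "real vec \<Rightarrow> real" where
  "inf_norm v = Max ((\<lambda>i. \<bar>v $ i\<bar>) ` {..<dim_vec v})"

type_synonym bits = "int \<Rightarrow> bool"

text \<open>A signed bit sequence $(p,a)$; the sign bit \<^const>\<open>True\<close> stands for $p=1$.\<close>
type_synonym sbits = "bool \<times> bits"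

definition bit_supp :: "bits \<Rightarrow> int set" where
  "bit_supp c = {i. c i}"

text \<open>$\max\mathcal{I}(c)$; only meaningful if \<^term>\<open>bit_supp c\<close> is nonempty and bounded above.\<close>
definition top_bit :: "bits \<Rightarrow> int" where
  "top_bit c = (GREATEST i. i \<in> bit_supp c)"

definition sbin_rep :: "sbits \<Rightarrow> real \<Rightarrow> bool" where
  "sbin_rep b x \<longleftrightarrow>
     (\<exists>s. ((\<lambda>i. of_bool (snd b i) * 2 powi i) has_sum s) UNIV \<and> x = (-1) ^ of_bool (fst b) * s)"

definition negabin_rep :: "bits \<Rightarrow> real \<Rightarrow> bool" where
  "negabin_rep c x \<longleftrightarrow> ((\<lambda>i. of_bool (c i) * (-2) powi i) has_sum x) UNIV"

text \<open>The choice of one representation per real number is a function \<open>rB\<close> (resp. \<open>rN\<close>), which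
  plays the role of $f_{\mathcal{B}}^{-1}$ (resp. $f_{\mathcal{N}}^{-1}$). The sets
  $\mathcal{B}$ and $\mathcal{N}$ of chosen representations are its range.\<close>

definition sbin_choice :: "(real \<Rightarrow> sbits) \<Rightarrow> bool" where
  "sbin_choice rB \<longleftrightarrow>
     (\<forall>x. sbin_rep (rB x) x) \<and>
     (\<forall>x. (\<exists>b. sbin_rep b x \<and> finite (bit_supp (snd b))) \<longrightarrow> finite (bit_supp (snd (rB x)))) \<and>
     fst (rB 0) = False"

definition negabin_choice :: "(real \<Rightarrow> bits) \<Rightarrow> bool" where
  "negabin_choice rN \<longleftrightarrow>
     (\<forall>x. negabin_rep (rN x) x) \<and>
     (\<forall>x. (\<exists>c. negabin_rep c x \<and> finite (bit_supp c)) \<longrightarrow> finite (bit_supp (rN x)))"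

definition fB :: "sbits \<Rightarrow> real" where
  "fB b = (-1) ^ of_bool (fst b) * (\<Sum>\<^sub>\<infinity>i. of_bool (snd b i) * 2 powi i)"

definition fN :: "bits \<Rightarrow> real" where
  "fN c = (\<Sum>\<^sub>\<infinity>i. of_bool (c i) * (-2) powi i)"

definition B_prec :: "(real \<Rightarrow> sbits) \<Rightarrow> nat \<Rightarrow> sbits set" where
  "B_prec rB k = {b \<in> range rB. \<exists>i. bit_supp (snd b) \<subseteq> {i..i + int k - 1}}"

definition trunc :: "int set \<Rightarrow> bits \<Rightarrow> bits" where
  "trunc S c = (\<lambda>i. i \<in> S \<and> c i)"

definition shift :: "int \<Rightarrow> bits \<Rightarrow> bits" where
  "shift l c = (\<lambda>i. c (i + l))"

text \<open>Identification of $(1,0)$ with the chosen representation $(0,0)$ of zero.\<close>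
definition sb_norm :: "sbits \<Rightarrow> sbits" where
  "sb_norm b = (if bit_supp (snd b) = {} then (False, snd b) else b)"

definition truncB :: "int set \<Rightarrow> sbits \<Rightarrow> sbits" where
  "truncB S b = sb_norm (fst b, trunc S (snd b))"

definition shiftB :: "int \<Rightarrow> sbits \<Rightarrow> sbits" where
  "shiftB l b = sb_norm (fst b, shift l (snd b))"

text \<open>Zero components have no bits, hence do not contribute to the maximum.\<close>
definition e_max :: "(real \<Rightarrow> sbits) \<Rightarrow> real vec \<Rightarrow> int" where
  "e_max rB x = Max ((\<lambda>i. top_bit (snd (rB (x $ i)))) ` {i. i < dim_vec x \<and> x $ i \<noteq> 0})"

text \<open>On a zero component the value of \<^const>\<open>top_bit\<close> is irrelevant: truncation keeps it zero.\<close>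
definition fl :: "nat \<Rightarrow> sbits \<Rightarrow> sbits" where
  "fl k b = truncB {j. j > top_bit (snd b) - int k} b"

definition kron :: "real mat \<Rightarrow> real mat \<Rightarrow> real mat" where
  "kron A B = mat (dim_row A * dim_row B) (dim_col A * dim_col B)
     (\<lambda>(i, j). A $$ (i div dim_row B, j div dim_col B) * B $$ (i mod dim_row B, j mod dim_col B))"

definition L_mat :: "real mat" where
  "L_mat = (1 / 16) \<cdot>\<^sub>m mat_of_rows_list 4
     [[ 4, 4,  4,  4],
      [ 5, 1, -1, -5],
      [-4, 4,  4, -4],
      [-2, 6, -6,  2]]"

fun L_tensor :: "nat \<Rightarrow> real mat" where
  "L_tensor 0 = 1\<^sub>m 1"
| "L_tensor (Suc d) = kron L_mat (L_tensor d)"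

definition L_lossy :: "int vec \<Rightarrow> int vec" where
  "L_lossy v =
    (let r = (\<lambda>a. a div 2);
         a1 = v $ 0; a2 = v $ 1; a3 = v $ 2; a4 = v $ 3;
         a1 = a1 + a4;
         a1 = r a1;
         a4 = a4 - a1;
         a3 = a3 + a2;
         a3 = r a3;
         a2 = a2 - a3;
         a1 = a1 + a3;
         a1 = r a1;
         a3 = a3 - a1;
         a4 = a4 + a2;
         a4 = r a4;
         a2 = a2 - a4;
         a4 = a4 + r a2;
         a2 = a2 - r a4
     in vec_of_list [a1, a2, a3, a4])"

text \<open>A vector of length $4^d$ is a $4\times\cdots\times4$ array whose coordinates in direction
  $m<d$ are the base-4 digits with weight $4^m$ of the index. The line through \<open>i\<close> in direction
  \<open>m\<close> consists of the indices \<open>line_index m i j\<close> for \<open>j < 4\<close>.\<close>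

definition coord :: "nat \<Rightarrow> nat \<Rightarrow> nat" where
  "coord m i = i div 4 ^ m mod 4"

definition line_index :: "nat \<Rightarrow> nat \<Rightarrow> nat \<Rightarrow> nat" where
  "line_index m i j = i - coord m i * 4 ^ m + j * 4 ^ m"

definition L_lossy_dir :: "nat \<Rightarrow> int vec \<Rightarrow> int vec" where
  "L_lossy_dir m v =
     vec (dim_vec v) (\<lambda>i. L_lossy (vec 4 (\<lambda>j. v $ line_index m i j)) $ coord m i)"

text \<open>\<open>dirs\<close> lists the directions in the order in which they are processed (because of the rounding
  the result depends on it).\<close>
definition L_lossy_tensor :: "nat list \<Rightarrow> int vec \<Rightarrow> int vec" where
  "L_lossy_tensor dirs v = fold L_lossy_dir dirs v"

definition zfp_ell :: "(real \<Rightarrow> sbits) \<Rightarrow> nat \<Rightarrow> real vec \<Rightarrow> int" where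
  "zfp_ell rB q x = e_max rB x - int q + 1"

definition C2 :: "(real \<Rightarrow> sbits) \<Rightarrow> nat \<Rightarrow> real vec \<Rightarrow> sbits vec" where
  "C2 rB q x = map_vec (truncB {0..}) (map_vec (shiftB (zfp_ell rB q x)) (map_vec rB x))"

text \<open>After \<open>C2\<close> all components are integers, so that \<^const>\<open>floor\<close> only changes the type.\<close>
definition C3 :: "(real \<Rightarrow> sbits) \<Rightarrow> nat list \<Rightarrow> sbits vec \<Rightarrow> sbits vec" where
  "C3 rB dirs a =
     map_vec rB (map_vec real_of_int (L_lossy_tensor dirs (map_vec floor (map_vec fB a))))"

definition C4 :: "(nat \<Rightarrow> nat) \<Rightarrow> 'a vec \<Rightarrow> 'a vec" where
  "C4 \<pi> a = vec (dim_vec a) (\<lambda>i. a $ \<pi> i)"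

definition C5 :: "(real \<Rightarrow> bits) \<Rightarrow> sbits vec \<Rightarrow> bits vec" where
  "C5 rN a = map_vec rN (map_vec fB a)"

definition C8 :: "nat \<Rightarrow> int \<Rightarrow> bits vec \<Rightarrow> bits vec" where
  "C8 q \<beta> a = map_vec (trunc {i. i > int q + 1 - \<beta>}) a"

definition D2 :: "nat \<Rightarrow> int \<Rightarrow> sbits vec \<Rightarrow> real vec" where
  "D2 k l a = map_vec fB (map_vec (shiftB (- l)) (map_vec (fl k) a))"

definition D3 :: "(real \<Rightarrow> sbits) \<Rightarrow> nat \<Rightarrow> sbits vec \<Rightarrow> sbits vec" where
  "D3 rB d a = map_vec rB (the (mat_inverse (L_tensor d)) *\<^sub>v map_vec fB a)"

definition D4 :: "(nat \<Rightarrow> nat) \<Rightarrow> 'a vec \<Rightarrow> 'a vec" where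
  "D4 \<pi> a = C4 (inv_into UNIV \<pi>) a"

definition D5 :: "(real \<Rightarrow> sbits) \<Rightarrow> bits vec \<Rightarrow> sbits vec" where
  "D5 rB a = map_vec rB (map_vec fN a)"

definition zfp_compress ::
    "(real \<Rightarrow> sbits) \<Rightarrow> (real \<Rightarrow> bits) \<Rightarrow> (nat \<Rightarrow> nat) \<Rightarrow> nat list \<Rightarrow> nat \<Rightarrow> int \<Rightarrow> real vec \<Rightarrow> bits vec" where
  "zfp_compress rB rN \<pi> dirs q \<beta> = C8 q \<beta> \<circ> C5 rN \<circ> C4 \<pi> \<circ> C3 rB dirs \<circ> C2 rB q"

text \<open>\<open>l\<close> is the value of \<^const>\<open>zfp_ell\<close> stored at compression.\<close>
definition zfp_decompress ::
    "(real \<Rightarrow> sbits) \<Rightarrow> (nat \<Rightarrow> nat) \<Rightarrow> nat \<Rightarrow> nat \<Rightarrow> int \<Rightarrow> bits vec \<Rightarrow> real vec" where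
  "zfp_decompress rB \<pi> d k l = D2 k l \<circ> D3 rB d \<circ> D4 \<pi> \<circ> D5 rB"

definition k_L :: "nat \<Rightarrow> real" where
  "k_L d = 7 / 4 * (2 ^ d - 1)"

definition K_beta :: "nat \<Rightarrow> nat \<Rightarrow> nat \<Rightarrow> int \<Rightarrow> real" where
  "K_beta d k q \<beta> =
     (15 / 4) ^ d *
     ((1 + eps (int k)) *
        (8 / 3 * eps \<beta> +
         eps (int q) * (1 + 8 / 3 * eps \<beta>) * (k_L d * (1 + eps (int q)) + 1))
      + eps (int k))"

end

theory Submission
  imports Defs "Jordan_Normal_Form.Determinant"
begin

text \<open>All rounding errors are bounded absolutely at the scale of the block-floating-point integers
  $y = 2^{-\ell}x$. Since some component of $x$ has leading bit $2^{e_{max}}$, we have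
  $\|y\|_\infty \ge 2^{q-1}$, so an absolute error $c$ is a relative error
  $c\,\epsilon_q$. Truncation to integers costs at most 1; each direction of the lossy transform costs
  at most $7/4$ and does not amplify earlier errors because $\|L\|_\infty = 1$, giving
  $\frac74 d \le k_L$ in total; dropping the negabinary bits up to index $q+1-\beta$ costs at most
  $\frac43 2^{q+1-\beta} = \frac83\epsilon_\beta 2^{q-1}$. The inverse transform multiplies the
  error by at most $\|L^{-1}\|_\infty^d = (15/4)^d$, and $fl_k$ adds a relative error
  $\epsilon_k$.\<close>

section \<open>Truncation of binary and negabinary expansions\<close>

text \<open>One family of terms serves both expansions: base 2 for the signed binary one, base -2
  for the negabinary one.\<close>

definition bterm :: "real \<Rightarrow> bits \<Rightarrow> int \<Rightarrow> real" where
  "bterm b c i = of_bool (c i) * b powi i"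

lemma has_sum_atMost_int_iff:
  fixes f :: "int \<Rightarrow> real"
  shows "(f has_sum s) {..m} \<longleftrightarrow> ((\<lambda>n::nat. f (m - int n)) has_sum s) UNIV"
proof -
  have "bij_betw (\<lambda>n::nat. m - int n) UNIV {..m}"
    by (rule bij_betwI[where g = "\<lambda>i. nat (m - i)"]) auto
  then show ?thesis
    using has_sum_reindex_bij_betw[of "\<lambda>n::nat. m - int n" UNIV "{..m}" f s] by simp
qed

lemma powi_diff_nat: "(a::real) \<noteq> 0 \<Longrightarrow> a powi (m - int n) = a powi m * (1 / a) ^ n"
  by (simp add: power_int_diff power_divide)

lemma has_sum_geometric:
  assumes "\<bar>r\<bar> < (1::real)"
  shows "((\<lambda>n. a * r ^ n) has_sum (a / (1 - r))) UNIV"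
proof -
  have "((\<lambda>n. r ^ n) has_sum (1 / (1 - r))) UNIV"
    by (rule norm_summable_imp_has_sum)
      (use assms geometric_sums[of r] summable_geometric[of "\<bar>r\<bar>"] in \<open>auto simp: power_abs\<close>)
  from has_sum_cmult_right[OF this, of a] show ?thesis by simp
qed

text \<open>The extreme case has every bit up to \<open>m\<close> set, which is a geometric series
  of ratio 1/2.\<close>

lemma binary_tail_bound:
  assumes "((bterm 2 c) has_sum s) {..m}"
  shows "0 \<le> s" and "s \<le> 2 * 2 powi m"
proof -
  show "0 \<le> s" by (rule has_sum_nonneg[OF assms]) (simp add: bterm_def)
  have "((\<lambda>n. 2 powi m * (1 / 2) ^ n) has_sum ((2::real) powi m / (1 - 1 / 2))) (UNIV :: nat set)"
    by (rule has_sum_geometric) simp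
  then show "s \<le> 2 * 2 powi m"
    using has_sum_mono[OF assms[unfolded has_sum_atMost_int_iff]]
    by (fastforce simp: bterm_def powi_diff_nat)
qed

text \<open>Only every second term can have a given sign, whence the factor $4/3$ instead of $2$; the
  indicator of the sign is written as a combination of the geometric series of ratio
  $\pm 1/2$.\<close>
lemma negabinary_tail_bound:
  assumes "((bterm (-2) c) has_sum s) {..m}"
  shows "\<bar>s\<bar> \<le> 4 / 3 * 2 powi m"
proof -
  define \<sigma> :: real where "\<sigma> = (-1) powi m"
  have \<sigma>: "\<sigma> = 1 \<or> \<sigma> = -1" by (simp add: \<sigma>_def power_int_minus_left)
  \<comment> \<open>For t = 1 or t = -1, \<open>g t n\<close> is 2^m (1/2)^n where t (-1)^n = 1 and
    0 elsewhere. With all bits set, \<open>g \<sigma>\<close> thus collects the positive terms and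
    \<open>g (-\<sigma>)\<close> the absolute values of the negative ones.\<close>
  define g where "g = (\<lambda>t n. 2 powi m / 2 * (1/2) ^ n + t * 2 powi m / 2 * (-(1/2::real)) ^ n)"
  have g: "(g t has_sum (2 powi m + t * 2 powi m / 3)) UNIV" for t
  proof -
    have "(g t has_sum (2 powi m / 2 / (1 - 1/2) + t * 2 powi m / 2 / (1 - - (1/2)))) UNIV"
      unfolding g_def by (intro has_sum_add has_sum_geometric) auto
    then show ?thesis by simp
  qed
  have bt: "bterm (-2) c (m - int n) = of_bool (c (m - int n)) * \<sigma> * 2 powi m * (-(1/2)) ^ n" for n
  proof -
    have "(-2::real) powi m = \<sigma> * 2 powi m"
      by (simp add: \<sigma>_def power_int_minus_left)
    then show ?thesis by (simp add: bterm_def powi_diff_nat power_divide)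
  qed
  note s = assms[unfolded has_sum_atMost_int_iff bt]
  have cases: "(-(1/2::real)) ^ n = (1/2) ^ n \<or> (-(1/2::real)) ^ n = - ((1/2) ^ n)" for n
    by (cases "even n") auto
  have pos: "0 < (2::real) powi m * (1/2) ^ n" for n :: nat by simp
  have "s \<le> 2 powi m + \<sigma> * 2 powi m / 3"
  proof (rule has_sum_mono[OF s g])
    fix n show "of_bool (c (m - int n)) * \<sigma> * 2 powi m * (-(1/2)) ^ n \<le> g \<sigma> n"
      using \<sigma> cases[of n] pos[of n] unfolding g_def of_bool_def by auto
  qed
  moreover have "- s \<le> 2 powi m + (-\<sigma>) * 2 powi m / 3"
  proof (rule has_sum_mono[OF _ g])
    show "((\<lambda>n. - (of_bool (c (m - int n)) * \<sigma> * 2 powi m * (-(1/2)) ^ n)) has_sum - s) UNIV"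
      using s unfolding has_sum_uminus by simp
    fix n show "- (of_bool (c (m - int n)) * \<sigma> * 2 powi m * (-(1/2)) ^ n) \<le> g (-\<sigma>) n"
      using \<sigma> cases[of n] pos[of n] unfolding g_def of_bool_def by auto
  qed
  moreover have "(0::real) < 2 powi m" by simp
  ultimately show ?thesis using \<sigma> by (auto simp: abs_le_iff)
qed

lemma infsum_bterm_trunc: "infsum (bterm b (trunc S c)) UNIV = infsum (bterm b c) S"
  by (rule infsum_cong_neutral) (auto simp: bterm_def trunc_def)

text \<open>The truncation error is itself a sum over the discarded indices, so the tail bounds
  apply to it.\<close>

lemma bterm_trunc_decomp:
  assumes "(bterm b c has_sum s) UNIV"
  shows "(bterm b c has_sum (s - infsum (bterm b (trunc S c)) UNIV)) (- S)"
proof -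
  have sm: "bterm b c summable_on A" for A
    using assms summable_on_subset_banach has_sum_imp_summable by blast
  have "infsum (bterm b c) (S \<union> - S) = infsum (bterm b c) S + infsum (bterm b c) (- S)"
    by (rule infsum_Un_disjoint) (use sm in auto)
  then have "infsum (bterm b c) (- S) = s - infsum (bterm b (trunc S c)) UNIV"
    using assms by (simp add: infsum_bterm_trunc infsumI)
  with sm show ?thesis by (metis has_sum_infsum)
qed

lemma fN_trunc_error:
  assumes "negabin_rep c x"
  shows "\<bar>fN (trunc {i. i > m} c) - x\<bar> \<le> 4 / 3 * 2 powi m"
proof -
  have "(bterm (-2) c has_sum (x - fN (trunc {i. i > m} c))) (- {i. i > m})"
    using bterm_trunc_decomp assms
    by (simp add: negabin_rep_def fN_def bterm_def[abs_def])
  moreover have "- {i. i > m} = {..m}" by auto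
  ultimately show ?thesis using negabinary_tail_bound by (metis abs_minus_commute)
qed

section \<open>Signed binary representations: truncation, shift and leading bit\<close>

definition bin_abs :: "bits \<Rightarrow> real" where
  "bin_abs c = infsum (bterm 2 c) UNIV"

lemma fB_bin_abs: "fB b = (-1) ^ of_bool (fst b) * bin_abs (snd b)"
  by (simp add: fB_def bin_abs_def bterm_def[abs_def])

lemma bin_abs_nonneg: "0 \<le> bin_abs c"
  unfolding bin_abs_def by (rule infsum_nonneg) (simp add: bterm_def)

lemma abs_fB: "\<bar>fB b\<bar> = bin_abs (snd b)"
  by (simp add: fB_bin_abs abs_mult bin_abs_nonneg)

lemma sbin_rep_has_sum:
  assumes "sbin_rep b x"
  shows "fB b = x" and "(bterm 2 (snd b) has_sum bin_abs (snd b)) UNIV"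
proof -
  obtain s where s: "(bterm 2 (snd b) has_sum s) UNIV" "x = (-1) ^ of_bool (fst b) * s"
    using assms by (auto simp: sbin_rep_def bterm_def[abs_def])
  then have "bin_abs (snd b) = s" by (simp add: bin_abs_def infsumI)
  with s show "fB b = x" "(bterm 2 (snd b) has_sum bin_abs (snd b)) UNIV"
    by (auto simp: fB_bin_abs)
qed

text \<open>Normalisation changes only the sign of an empty bit sequence, whose value is 0 with
  either sign.\<close>

lemma fB_sb_norm: "fB (sb_norm b) = fB b"
  by (simp add: sb_norm_def fB_def bit_supp_def)

lemma fB_truncB: "fB (truncB S b) = (-1) ^ of_bool (fst b) * bin_abs (trunc S (snd b))"
  by (simp add: truncB_def fB_sb_norm) (simp add: fB_bin_abs)

lemma bterm_shift: "b \<noteq> 0 \<Longrightarrow> bterm b (shift l c) = (\<lambda>i. b powi (- l) * bterm b c (i + l))"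
  by (simp add: fun_eq_iff bterm_def shift_def power_int_add power_int_minus)

lemma bij_betw_add_int: "bij_betw (\<lambda>i::int. i + l) UNIV UNIV"
  by (rule bij_betwI[where g = "\<lambda>i. i - l"]) auto

lemma bin_abs_shift: "bin_abs (shift l c) = 2 powi (- l) * bin_abs c"
  using infsum_reindex_bij_betw[OF bij_betw_add_int[of l], of "bterm 2 c"]
  by (simp add: bin_abs_def bterm_shift infsum_cmult_right')

lemma fB_shiftB: "fB (shiftB l b) = 2 powi (- l) * fB b"
  by (simp add: shiftB_def fB_sb_norm) (simp add: fB_bin_abs bin_abs_shift)

text \<open>Truncation errors are bounded below for any convergent representation. Convergence has
  to be carried along because \<open>infsum\<close> assigns 0 to a divergent family.\<close>

lemma sbin_rep_shiftB:
  assumes "sbin_rep b x"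
  shows "sbin_rep (shiftB l b) (2 powi (- l) * x)"
proof -
  have "bterm 2 (snd b) summable_on UNIV"
    using sbin_rep_has_sum(2)[OF assms] has_sum_imp_summable by blast
  then have "(\<lambda>i. bterm 2 (snd b) (i + l)) summable_on UNIV"
    using summable_on_reindex_bij_betw[OF bij_betw_add_int[of l], of "bterm 2 (snd b)"] by simp
  then have "bterm 2 (snd (shiftB l b)) summable_on UNIV"
    by (simp add: shiftB_def sb_norm_def bterm_shift summable_on_cmult_right)
  then have "(bterm 2 (snd (shiftB l b)) has_sum bin_abs (snd (shiftB l b))) UNIV"
    by (simp add: bin_abs_def has_sum_infsum)
  moreover have "2 powi (- l) * x = fB (shiftB l b)"
    using sbin_rep_has_sum(1)[OF assms] by (simp add: fB_shiftB)
  ultimately show ?thesis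
    by (auto simp: sbin_rep_def bterm_def[abs_def] fB_bin_abs)
qed

text \<open>Each set bit i contributes 2^i to a convergent sum of nonnegative terms, so i is bounded
  by the size of the sum. This gives \<open>top_bit\<close> its meaning.\<close>

lemma sbin_rep_bdd_above:
  assumes "sbin_rep b x"
  shows "bdd_above (bit_supp (snd b))"
proof -
  note s = sbin_rep_has_sum(2)[OF assms]
  obtain n where n: "bin_abs (snd b) < 2 ^ n"
    using real_arch_pow[of 2 "bin_abs (snd b)"] by auto
  show ?thesis
  proof (rule bdd_aboveI[of _ "int n"])
    fix i assume "i \<in> bit_supp (snd b)"
    then have "2 powi i \<le> bin_abs (snd b)"
      using finite_sum_le_has_sum[OF s, of "{i}"] by (auto simp: bterm_def bit_supp_def)
    with n have "(2::real) powi i < 2 powi int n" by simp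
    then show "i \<le> int n" using power_int_strict_increasing power_int_increasing
      by (metis linorder_not_less one_le_numeral order_less_imp_le)
  qed
qed

lemma top_bit_Max:
  assumes "bit_supp c \<noteq> {}" and "bdd_above (bit_supp c)"
  shows "top_bit c \<in> bit_supp c" and "\<And>i. i \<in> bit_supp c \<Longrightarrow> i \<le> top_bit c"
proof -
  obtain j where j: "j \<in> bit_supp c" using assms(1) by auto
  obtain M where M: "\<And>i. i \<in> bit_supp c \<Longrightarrow> i \<le> M" using assms(2) by (auto simp: bdd_above_def)
  \<comment> \<open>Infinitely many low bits may be set; cutting at one set bit \<open>j\<close>
    leaves a finite set with the same maximum.\<close>
  define F where "F = bit_supp c \<inter> {j..M}"
  have fin: "finite F" "j \<in> F" using j M by (auto simp: F_def)
  have mx: "Max F \<in> bit_supp c" using Max_in[of F] fin by (force simp: F_def)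
  have le: "i \<le> Max F" if "i \<in> bit_supp c" for i
  proof (cases "i \<ge> j")
    case True then show ?thesis using that M fin by (intro Max_ge) (auto simp: F_def)
  next
    case False then show ?thesis using Max_ge[OF fin] by simp
  qed
  have "top_bit c = Max F"
    unfolding top_bit_def by (rule Greatest_equality) (use mx le in auto)
  with mx le show "top_bit c \<in> bit_supp c" "\<And>i. i \<in> bit_supp c \<Longrightarrow> i \<le> top_bit c" by auto
qed

text \<open>The leading bit is one of the nonnegative summands of the absolute value.\<close>

lemma sbin_rep_nonzero_top_bit:
  assumes "sbin_rep b x" and "x \<noteq> 0"
  shows "bit_supp (snd b) \<noteq> {}" and "2 powi (top_bit (snd b)) \<le> \<bar>x\<bar>"
proof -
  note b = sbin_rep_has_sum[OF assms(1)]
  show ne: "bit_supp (snd b) \<noteq> {}"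
  proof
    assume "bit_supp (snd b) = {}"
    then have "bterm 2 (snd b) = (\<lambda>_. 0)" by (auto simp: bterm_def bit_supp_def)
    then have "bin_abs (snd b) = 0" by (simp add: bin_abs_def)
    with b(1) assms(2) show False by (simp add: fB_bin_abs)
  qed
  have "top_bit (snd b) \<in> bit_supp (snd b)"
    using top_bit_Max(1)[OF ne sbin_rep_bdd_above[OF assms(1)]] .
  then show "2 powi (top_bit (snd b)) \<le> \<bar>x\<bar>"
    using finite_sum_le_has_sum[OF b(2), of "{top_bit (snd b)}"] abs_fB[of b] b(1)
    by (auto simp: bterm_def bit_supp_def)
qed

lemma fB_truncB_error:
  assumes "sbin_rep b x"
  shows "\<bar>fB (truncB {i. i > m} b) - x\<bar> \<le> 2 * 2 powi m"
proof -
  note b = sbin_rep_has_sum[OF assms]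
  have "(bterm 2 (snd b) has_sum (bin_abs (snd b) - bin_abs (trunc {i. i > m} (snd b)))) (- {i. i > m})"
    using bterm_trunc_decomp[OF b(2)] by (simp add: bin_abs_def)
  moreover have "- {i. i > m} = {..m}" by auto
  ultimately have "0 \<le> bin_abs (snd b) - bin_abs (trunc {i. i > m} (snd b))"
    "bin_abs (snd b) - bin_abs (trunc {i. i > m} (snd b)) \<le> 2 * 2 powi m"
    using binary_tail_bound by metis+
  then show ?thesis
    using b(1) by (cases "fst b") (auto simp: fB_truncB fB_bin_abs[of b])
qed

text \<open>The discarded bits add up to at most \<open>eps k\<close> times the leading power of
  two, which is at most the number itself in absolute value.\<close>

lemma fB_fl_error:
  assumes "sbin_rep b x"
  shows "\<bar>fB (fl k b) - x\<bar> \<le> eps (int k) * \<bar>x\<bar>"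
proof (cases "x = 0")
  case True
  \<comment> \<open>For zero, \<open>top_bit\<close> is an unspecified value, so the argument is
    that no truncation whatsoever can leave a nonzero value.\<close>
  have "bin_abs (snd b) = 0" using abs_fB[of b] sbin_rep_has_sum(1)[OF assms] True by simp
  have "bterm 2 (snd b) i = 0" for i
  proof -
    have "sum (bterm 2 (snd b)) {i} \<le> bin_abs (snd b)"
      by (rule finite_sum_le_has_sum[OF sbin_rep_has_sum(2)[OF assms]]) (auto simp: bterm_def)
    moreover have "0 \<le> bterm 2 (snd b) i" by (simp add: bterm_def)
    ultimately show ?thesis using \<open>bin_abs (snd b) = 0\<close> by simp
  qed
  then have "bterm 2 (snd b) = (\<lambda>_. 0)" by auto
  then have "bin_abs (trunc S (snd b)) = 0" for S
    by (simp add: bin_abs_def infsum_bterm_trunc)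
  with True show ?thesis by (simp add: fl_def fB_truncB)
next
  case False
  have "\<bar>fB (fl k b) - x\<bar> \<le> 2 * 2 powi (top_bit (snd b) - int k)"
    unfolding fl_def by (rule fB_truncB_error[OF assms])
  also have "\<dots> = eps (int k) * 2 powi (top_bit (snd b))"
    by (simp add: eps_def power_int_diff)
  also have "\<dots> \<le> eps (int k) * \<bar>x\<bar>"
    using sbin_rep_nonzero_top_bit(2)[OF assms False] by (simp add: eps_def)
  finally show ?thesis .
qed

text \<open>Bits are bounded above, so only finitely many nonnegative powers of two remain; hence
  \<open>floor\<close> in \<open>C3\<close> loses nothing.\<close>

lemma fB_truncB_nonneg_int:
  assumes "sbin_rep b x"
  shows "of_int \<lfloor>fB (truncB {0..} b)\<rfloor> = fB (truncB {0..} b)"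
proof -
  define F where "F = {i. i \<ge> 0 \<and> snd b i}"
  obtain M where "\<And>i. i \<in> bit_supp (snd b) \<Longrightarrow> i \<le> M"
    using sbin_rep_bdd_above[OF assms] by (auto simp: bdd_above_def)
  then have "F \<subseteq> {0..M}" by (auto simp: F_def bit_supp_def)
  then have fin: "finite F" using finite_subset by blast
  have "bin_abs (trunc {0..} (snd b)) = infsum (\<lambda>i. 2 powi i) F"
    unfolding bin_abs_def
    by (rule infsum_cong_neutral) (auto simp: bterm_def trunc_def F_def)
  also have "\<dots> = (\<Sum>i\<in>F. of_int (2 ^ nat i))"
    using fin by (auto simp: F_def power_int_def intro!: sum.cong)
  also have "\<dots> = of_int (\<Sum>i\<in>F. 2 ^ nat i)" by simp
  finally have "bin_abs (trunc {0..} (snd b)) \<in> \<int>" by (metis Ints_of_int)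
  then have "fB (truncB {0..} b) \<in> \<int>" by (simp add: fB_truncB)
  then show ?thesis by simp
qed

section \<open>Tensor powers of the transform\<close>

lemma coord_less: "coord m i < 4"
  by (simp add: coord_def)

lemma coord_low: "m < d \<Longrightarrow> coord m (c * 4 ^ d + n) = coord m n"
proof -
  assume "m < d"
  then obtain e where "d = Suc (m + e)" using less_imp_Suc_add by blast
  then have "c * 4 ^ d + n = n + 4 ^ m * (4 * (c * 4 ^ e))"
    by (simp add: power_add)
  then have "(c * 4 ^ d + n) div 4 ^ m = n div 4 ^ m + 4 * (c * 4 ^ e)"
    by (simp only: div_mult_self2[of "4 ^ m :: nat"] power_not_zero) simp
  then show ?thesis by (simp add: coord_def)
qed

lemma coord_mod: "m < d \<Longrightarrow> coord m (n mod 4 ^ d) = coord m n"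
  using coord_low[of m d "n div 4 ^ d" "n mod 4 ^ d"] by (simp only: div_mult_mod_eq)

lemma coord_top: "n < 4 ^ d \<Longrightarrow> c < 4 \<Longrightarrow> coord d (c * 4 ^ d + n) = c"
  by (simp add: coord_def)

lemma sum_base4_split:
  fixes g :: "nat \<Rightarrow> 'a::comm_monoid_add"
  shows "(\<Sum>k<4 ^ Suc d. g k) = (\<Sum>c<4. \<Sum>n<4 ^ d. g (c * 4 ^ d + n))"
proof -
  have "(\<Sum>k<4 ^ Suc d. g k) = (\<Sum>c<4. sum g {c * 4 ^ d ..< c * 4 ^ d + 4 ^ d})"
    using sum.nat_group[of g "4 ^ d" 4] by simp
  also have "\<dots> = (\<Sum>c<4. \<Sum>n<4 ^ d. g (c * 4 ^ d + n))"
    by (rule sum.cong[OF refl], subst sum.atLeastLessThan_shift_0) (simp add: atLeast0LessThan)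
  finally show ?thesis .
qed

text \<open>Distributive law: the indices below 4^d run through all d-tuples of digits exactly once.
  The induction splits off the top digit.\<close>

lemma sum_prod_coord:
  fixes f :: "nat \<Rightarrow> nat \<Rightarrow> 'a::comm_semiring_1"
  shows "(\<Sum>k<4 ^ d. \<Prod>m<d. f m (coord m k)) = (\<Prod>m<d. \<Sum>c<4. f m c)"
proof (induction d)
  case 0 then show ?case by simp
next
  case (Suc d)
  have "(\<Sum>k<4 ^ Suc d. \<Prod>m<Suc d. f m (coord m k))
      = (\<Sum>c<4. \<Sum>n<4 ^ d. (\<Prod>m<d. f m (coord m n)) * f d c)"
    unfolding sum_base4_split
    by (intro sum.cong refl) (simp add: coord_low coord_top)
  also have "\<dots> = (\<Sum>n<4 ^ d. \<Prod>m<d. f m (coord m n)) * (\<Sum>c<4. f d c)"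
    by (simp add: sum_distrib_right sum_distrib_left sum.swap[of _ "{..<4}"])
  finally show ?case by (simp add: Suc.IH)
qed

lemma eq_if_coord_eq:
  assumes "i < 4 ^ d" and "j < 4 ^ d" and "\<And>m. m < d \<Longrightarrow> coord m i = coord m j"
  shows "i = j"
  using assms
proof (induction d arbitrary: i j)
  case 0 then show ?case by simp
next
  case (Suc d)
  have *: "n = coord d n * 4 ^ d + n mod 4 ^ d" if "n < 4 ^ Suc d" for n
  proof -
    have "coord d n = n div 4 ^ d"
      using that by (simp add: coord_def less_mult_imp_div_less)
    then show ?thesis by (simp only: div_mult_mod_eq)
  qed
  have "i mod 4 ^ d = j mod 4 ^ d"
    by (rule Suc.IH) (use Suc.prems coord_mod in auto)
  then show ?case using *[OF Suc.prems(1)] *[OF Suc.prems(2)] Suc.prems(3)[of d] by simp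
qed

text \<open>Entries of a Kronecker product of 4 x 4 matrices. The factor may depend on the
  direction, so that transforms along only some of the directions are covered too.\<close>

definition tensor :: "nat \<Rightarrow> (nat \<Rightarrow> nat \<Rightarrow> nat \<Rightarrow> real) \<Rightarrow> nat \<Rightarrow> nat \<Rightarrow> real" where
  "tensor d F i j = (\<Prod>m<d. F m (coord m i) (coord m j))"

definition delta :: "nat \<Rightarrow> nat \<Rightarrow> real" where
  "delta a b = of_bool (a = b)"

lemma tensor_cong:
  assumes "\<And>m a b. m < d \<Longrightarrow> a < 4 \<Longrightarrow> b < 4 \<Longrightarrow> F m a b = G m a b"
  shows "tensor d F i j = tensor d G i j"
  unfolding tensor_def by (intro prod.cong) (auto simp: assms coord_less)

text \<open>Mixed-product rule for Kronecker products: the sum over the middle index factors digit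
  by digit.\<close>

lemma tensor_mult:
  "(\<Sum>k<4 ^ d. tensor d F i k * tensor d G k j) = tensor d (\<lambda>m a b. \<Sum>c<4. F m a c * G m c b) i j"
  using sum_prod_coord[of "\<lambda>m c. F m (coord m i) c * G m c (coord m j)" d]
  by (simp add: tensor_def prod.distrib)

lemma tensor_delta:
  assumes "i < 4 ^ d" and "j < 4 ^ d"
  shows "tensor d (\<lambda>_. delta) i j = of_bool (i = j)"
proof (cases "i = j")
  case False
  then obtain m where "m < d" "coord m i \<noteq> coord m j" using eq_if_coord_eq assms by blast
  then show ?thesis using False by (auto simp: tensor_def delta_def intro!: prod_zero)
qed (simp add: tensor_def delta_def)

text \<open>The absolute row sum of a Kronecker product is the product of the row sums of its
  factors, so their infinity norms multiply.\<close>

lemma tensor_apply_bound: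
  assumes "\<And>m a. m < d \<Longrightarrow> a < 4 \<Longrightarrow> (\<Sum>c<4. \<bar>F m a c\<bar>) \<le> K"
    and "\<And>j. j < 4 ^ d \<Longrightarrow> \<bar>v j\<bar> \<le> B"
  shows "\<bar>\<Sum>j<4 ^ d. tensor d F i j * v j\<bar> \<le> K ^ d * B"
proof -
  have "0 \<le> B" using assms(2)[of 0] by simp
  have "\<bar>\<Sum>j<4 ^ d. tensor d F i j * v j\<bar> \<le> (\<Sum>j<4 ^ d. \<bar>tensor d F i j\<bar> * B)"
    by (rule order_trans[OF sum_abs]) (auto intro!: sum_mono mult_left_mono simp: abs_mult assms(2))
  also have "\<dots> = (\<Prod>m<d. \<Sum>c<4. \<bar>F m (coord m i) c\<bar>) * B"
    using sum_prod_coord[of "\<lambda>m c. \<bar>F m (coord m i) c\<bar>" d]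
    by (simp add: tensor_def abs_prod sum_distrib_right[symmetric])
  also have "\<dots> \<le> (\<Prod>m<d. K) * B"
    using \<open>0 \<le> B\<close> by (intro mult_right_mono prod_mono) (auto simp: assms(1) coord_less sum_nonneg)
  finally show ?thesis by simp
qed

section \<open>Lines of the 4 x ... x 4 array\<close>

lemma line_index_eq:
  "line_index m i c = i div 4 ^ Suc m * 4 ^ Suc m + c * 4 ^ m + i mod 4 ^ m"
proof -
  have "i = i div 4 ^ Suc m * 4 ^ Suc m + i mod 4 ^ Suc m"
    by (rule div_mult_mod_eq[symmetric])
  also have "i mod 4 ^ Suc m = coord m i * 4 ^ m + i mod 4 ^ m"
    unfolding power_Suc2 mod_mult2_eq coord_def by (simp only: mult.commute)
  finally show ?thesis unfolding line_index_def by linarith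
qed

lemma coord_line_index:
  assumes "c < 4"
  shows "coord m' (line_index m i c) = (if m' = m then c else coord m' i)"
proof -
  \<comment> \<open>The digits up to position \<open>m\<close> cause no carry into the higher
    ones.\<close>
  have lt: "c * 4 ^ m + i mod 4 ^ m < 4 ^ Suc m"
  proof -
    have "c * 4 ^ m \<le> 3 * 4 ^ m" using assms by (intro mult_right_mono) auto
    moreover have "i mod 4 ^ m < 4 ^ m" by simp
    ultimately show ?thesis unfolding power_Suc by linarith
  qed
  consider "m' < m" | "m' = m" | "m < m'" by linarith
  then show ?thesis
  proof cases
    case 1
    have "line_index m i c = (i div 4 ^ Suc m * 4 + c) * 4 ^ m + i mod 4 ^ m"
      by (simp add: line_index_eq algebra_simps)
    then have "coord m' (line_index m i c) = coord m' (i mod 4 ^ m)" using coord_low[OF 1] by metis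
    also have "\<dots> = coord m' i" using 1 by (rule coord_mod)
    finally show ?thesis using 1 by simp
  next
    case 2
    have "coord m (line_index m i c) = coord m (c * 4 ^ m + i mod 4 ^ m)"
      using coord_low[of m "Suc m" "i div 4 ^ Suc m" "c * 4 ^ m + i mod 4 ^ m"]
      by (simp add: line_index_eq add.assoc)
    also have "\<dots> = c" using assms by (intro coord_top) auto
    finally show ?thesis using 2 by simp
  next
    case 3
    then obtain e where e: "m' = Suc m + e" using less_imp_Suc_add by force
    have "line_index m i c div 4 ^ Suc m = i div 4 ^ Suc m"
      using lt by (simp add: line_index_eq add.assoc del: power_Suc)
    then have "line_index m i c div 4 ^ m' = i div 4 ^ m'"
      by (simp only: e power_add div_mult2_eq)
    then show ?thesis using 3 by (simp add: coord_def)
  qed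
qed

lemma line_index_less:
  assumes "c < 4" and "m < d" and "i < 4 ^ d"
  shows "line_index m i c < 4 ^ d"
proof -
  obtain e where d: "d = Suc m + e" using \<open>m < d\<close> less_imp_Suc_add by force
  have "i div 4 ^ Suc m < 4 ^ e"
    using assms(3) by (intro less_mult_imp_div_less) (simp add: d power_add mult.commute mult.left_commute)
  then have "Suc (i div 4 ^ Suc m) * 4 ^ Suc m \<le> 4 ^ e * 4 ^ Suc m"
    by (intro mult_right_mono) auto
  moreover have "c * 4 ^ m \<le> 3 * 4 ^ m" using assms(1) by (intro mult_right_mono) auto
  moreover have "i mod 4 ^ m < 4 ^ m" by simp
  moreover have "(4::nat) ^ d = 4 ^ e * 4 ^ Suc m" by (simp add: d power_add)
  moreover have "(4::nat) ^ Suc m = 4 * 4 ^ m" by simp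
  ultimately show ?thesis unfolding line_index_eq mult_Suc by linarith
qed

text \<open>With identities in all other directions, the entry at (i, k) vanishes unless k agrees
  with i in every digit except the m-th, that is, unless k lies on the line through i.\<close>

lemma tensor_single:
  assumes "m < d" and "i < 4 ^ d"
  shows "(\<Sum>k<4 ^ d. tensor d (\<lambda>m'. if m' = m then F else delta) i k * u k)
       = (\<Sum>c<4. F (coord m i) c * u (line_index m i c))"
proof -
  let ?T = "tensor d (\<lambda>m'. if m' = m then F else delta)"
  have inj: "inj_on (line_index m i) {..<4}"
    by (rule inj_onI) (metis coord_line_index lessThan_iff)
  have zero: "?T i k = 0" if k: "k < 4 ^ d" "k \<notin> line_index m i ` {..<4}" for k
  proof -
    \<comment> \<open>Off the line, k is compared with the line point having the same m-th digit;
      the digit in which they differ must then belong to another direction.\<close>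
    have "k \<noteq> line_index m i (coord m k)" using k coord_less by blast
    then obtain m' where "m' < d" "coord m' k \<noteq> coord m' (line_index m i (coord m k))"
      using eq_if_coord_eq[OF k(1) line_index_less[OF coord_less assms]] by blast
    then have "m' < d" "m' \<noteq> m" "coord m' i \<noteq> coord m' k"
      by (auto simp: coord_line_index coord_less split: if_splits)
    then show ?thesis unfolding tensor_def
      by (intro prod_zero) (auto simp: delta_def intro!: bexI[of _ m'])
  qed
  have T: "?T i (line_index m i c) = F (coord m i) c" if "c < 4" for c
  proof -
    have "?T i (line_index m i c) = (\<Prod>m'<d. if m' = m then F (coord m i) c else 1)"
      unfolding tensor_def using that by (intro prod.cong) (auto simp: coord_line_index delta_def)
    then show ?thesis using assms(1) by simp
  qed
  have "(\<Sum>k<4 ^ d. ?T i k * u k) = (\<Sum>k\<in>line_index m i ` {..<4}. ?T i k * u k)"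
    by (rule sum.mono_neutral_right) (use line_index_less assms zero in auto)
  also have "\<dots> = (\<Sum>c<4. F (coord m i) c * u (line_index m i c))"
    by (simp add: sum.reindex[OF inj] T)
  finally show ?thesis .
qed

section \<open>The matrix L, its inverse and their tensor powers\<close>

lemma lessThan_4: "{..<4::nat} = {0, 1, 2, 3}" by auto

definition L_entry :: "nat \<Rightarrow> nat \<Rightarrow> real" where
  "L_entry a b = [[4, 4, 4, 4], [5, 1, -1, -5], [-4, 4, 4, -4], [-2, 6, -6, 2]] ! a ! b / 16"

text \<open>The inverse of L in closed form. Each row has absolute sum 15/4, the origin of the
  factor (15/4)^d.\<close>

definition L_inv_entry :: "nat \<Rightarrow> nat \<Rightarrow> real" where
  "L_inv_entry a b = [[4, 6, -4, -1], [4, 2, 4, 5], [4, -2, 4, -5], [4, -6, -4, 1]] ! a ! b / 4"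

lemma less_4_cases: "a < 4 \<Longrightarrow> a = 0 \<or> a = 1 \<or> a = 2 \<or> a = (3::nat)" by auto

lemma L_mat_carrier: "L_mat \<in> carrier_mat 4 4"
  by (rule carrier_matI) (simp_all add: L_mat_def mat_of_rows_list_def)

lemma L_mat_index: "a < 4 \<Longrightarrow> b < 4 \<Longrightarrow> L_mat $$ (a, b) = L_entry a b"
  by (simp add: L_mat_def mat_of_rows_list_def L_entry_def)

lemma L_tensor_carrier: "L_tensor d \<in> carrier_mat (4 ^ d) (4 ^ d)"
  by (induction d) (use L_mat_carrier in \<open>auto simp: kron_def\<close>)

text \<open>\<open>kron\<close> with \<open>L_mat\<close> on the left lets the new factor act on the
  top base-4 digit and the old ones on the remainder.\<close>

lemma L_tensor_index:
  "i < 4 ^ d \<Longrightarrow> j < 4 ^ d \<Longrightarrow> L_tensor d $$ (i, j) = tensor d (\<lambda>_. L_entry) i j"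
proof (induction d arbitrary: i j)
  case 0 then show ?case by (simp add: tensor_def)
next
  case (Suc d)
  have top: "coord d n = n div 4 ^ d" "n div 4 ^ d < 4" if "n < 4 ^ Suc d" for n
    using that by (auto simp: coord_def less_mult_imp_div_less)
  have "L_tensor (Suc d) $$ (i, j)
      = L_mat $$ (i div 4 ^ d, j div 4 ^ d) * L_tensor d $$ (i mod 4 ^ d, j mod 4 ^ d)"
    using Suc.prems L_tensor_carrier[of d] L_mat_carrier by (auto simp: kron_def)
  also have "\<dots> = L_entry (coord d i) (coord d j) * tensor d (\<lambda>_. L_entry) (i mod 4 ^ d) (j mod 4 ^ d)"
    using top Suc.prems by (simp add: Suc.IH L_mat_index)
  also have "\<dots> = tensor (Suc d) (\<lambda>_. L_entry) i j"
    by (simp add: tensor_def coord_mod)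
  finally show ?case .
qed

lemma L_entry_row_sum: "a < 4 \<Longrightarrow> (\<Sum>c<4. \<bar>L_entry a c\<bar>) \<le> 1"
  by (drule less_4_cases) (auto simp: L_entry_def lessThan_4)

lemma L_inv_entry_row_sum: "a < 4 \<Longrightarrow> (\<Sum>c<4. \<bar>L_inv_entry a c\<bar>) \<le> 15 / 4"
  by (drule less_4_cases) (auto simp: L_inv_entry_def lessThan_4)

lemma L_inv_entry_mult:
  "a < 4 \<Longrightarrow> b < 4 \<Longrightarrow> (\<Sum>c<4. L_inv_entry a c * L_entry c b) = delta a b"
  by (drule less_4_cases)+ (auto simp: L_inv_entry_def L_entry_def delta_def lessThan_4)

lemma tensor_L_inv_mult:
  assumes "i < 4 ^ d" and "j < 4 ^ d"
  shows "(\<Sum>k<4 ^ d. tensor d (\<lambda>_. L_inv_entry) i k * tensor d (\<lambda>_. L_entry) k j) = of_bool (i = j)"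
proof -
  have "(\<Sum>k<4 ^ d. tensor d (\<lambda>_. L_inv_entry) i k * tensor d (\<lambda>_. L_entry) k j)
      = tensor d (\<lambda>_. delta) i j"
    unfolding tensor_mult by (rule tensor_cong) (simp add: L_inv_entry_mult)
  then show ?thesis by (simp add: tensor_delta assms)
qed

lemma mult_mat_vec_index_sum:
  assumes "A \<in> carrier_mat n n" and "v \<in> carrier_vec n" and "i < n"
  shows "(A *\<^sub>v v) $ i = (\<Sum>j<n. A $$ (i, j) * v $ j)"
  using assms by (auto simp: scalar_prod_def atLeast0LessThan intro!: sum.cong)

text \<open>\<open>mat_inverse\<close> returns an option. The tensor power of the explicit inverse
  is a left inverse, hence two-sided for square matrices, which rules out
  \<open>None\<close>.\<close>

lemma mat_inverse_L_tensor:
  assumes "w \<in> carrier_vec (4 ^ d)"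
  defines "u \<equiv> the (mat_inverse (L_tensor d)) *\<^sub>v w"
  shows "u \<in> carrier_vec (4 ^ d)" and "L_tensor d *\<^sub>v u = w"
proof -
  define C where "C = mat (4 ^ d) (4 ^ d) (\<lambda>(i, j). tensor d (\<lambda>_. L_inv_entry) i j)"
  have C: "C \<in> carrier_mat (4 ^ d) (4 ^ d)" by (simp add: C_def)
  have CL: "C * L_tensor d = 1\<^sub>m (4 ^ d)"
  proof (rule eq_matI)
    fix i j assume "i < dim_row (1\<^sub>m (4 ^ d) :: real mat)" "j < dim_col (1\<^sub>m (4 ^ d) :: real mat)"
    then have ij: "i < 4 ^ d" "j < 4 ^ d" by auto
    then have "(C * L_tensor d) $$ (i, j)
        = (\<Sum>k<4 ^ d. tensor d (\<lambda>_. L_inv_entry) i k * tensor d (\<lambda>_. L_entry) k j)"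
      using L_tensor_carrier[of d]
      by (auto simp: C_def scalar_prod_def L_tensor_index atLeast0LessThan intro!: sum.cong)
    then show "(C * L_tensor d) $$ (i, j) = 1\<^sub>m (4 ^ d) $$ (i, j)"
      using ij by (simp add: tensor_L_inv_mult)
  qed (use L_tensor_carrier[of d] in \<open>auto simp: C_def\<close>)
  have LC: "L_tensor d * C = 1\<^sub>m (4 ^ d)"
    by (rule mat_mult_left_right_inverse[OF C L_tensor_carrier CL])
  have "L_tensor d \<in> Units (ring_mat TYPE(real) (4 ^ d) ())"
    using C CL LC L_tensor_carrier[of d] by (auto simp: Units_def ring_mat_def)
  then have "mat_inverse (L_tensor d) \<noteq> None"
    using mat_inverse(1)[OF L_tensor_carrier, of d "()"] by blast
  then obtain B where B: "mat_inverse (L_tensor d) = Some B" by blast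
  note B' = mat_inverse(2)[OF L_tensor_carrier B]
  show "u \<in> carrier_vec (4 ^ d)" using B B' assms(1) by (auto simp: u_def)
  have "L_tensor d *\<^sub>v (B *\<^sub>v w) = (L_tensor d * B) *\<^sub>v w"
    using assoc_mult_mat_vec[OF L_tensor_carrier[of d] _ assms(1), of B] B' by simp
  then show "L_tensor d *\<^sub>v u = w" using B B' assms(1) by (simp add: u_def)
qed

text \<open>Applying the tensor power of the explicit inverse recovers \<open>u\<close>, and its
  absolute row sums are at most (15/4)^d.\<close>

lemma L_tensor_inverse_bound:
  assumes "u \<in> carrier_vec (4 ^ d)"
    and "\<And>i. i < 4 ^ d \<Longrightarrow> \<bar>(L_tensor d *\<^sub>v u) $ i\<bar> \<le> B"
    and "i < 4 ^ d"
  shows "\<bar>u $ i\<bar> \<le> (15 / 4) ^ d * B"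
proof -
  have "(\<Sum>k<4 ^ d. tensor d (\<lambda>_. L_inv_entry) i k * (L_tensor d *\<^sub>v u) $ k)
      = (\<Sum>k<4 ^ d. \<Sum>j<4 ^ d. tensor d (\<lambda>_. L_inv_entry) i k * tensor d (\<lambda>_. L_entry) k j * u $ j)"
    by (intro sum.cong refl)
      (simp add: mult_mat_vec_index_sum[OF L_tensor_carrier assms(1)] L_tensor_index
        sum_distrib_left mult.assoc)
  also have "\<dots> = (\<Sum>j<4 ^ d. of_bool (i = j) * u $ j)"
    by (subst sum.swap) (simp add: sum_distrib_right[symmetric] tensor_L_inv_mult assms(3))
  also have "\<dots> = u $ i" using assms(3) by simp
  finally have "u $ i = (\<Sum>k<4 ^ d. tensor d (\<lambda>_. L_inv_entry) i k * (L_tensor d *\<^sub>v u) $ k)" ..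
  then show ?thesis using tensor_apply_bound[OF L_inv_entry_row_sum assms(2)] by simp
qed

lemma L_tensor_bound:
  assumes "u \<in> carrier_vec (4 ^ d)" and "\<And>i. i < 4 ^ d \<Longrightarrow> \<bar>u $ i\<bar> \<le> B" and "i < 4 ^ d"
  shows "\<bar>(L_tensor d *\<^sub>v u) $ i\<bar> \<le> B"
proof -
  have "(L_tensor d *\<^sub>v u) $ i = (\<Sum>j<4 ^ d. tensor d (\<lambda>_. L_entry) i j * u $ j)"
    using assms(3) by (simp add: mult_mat_vec_index_sum[OF L_tensor_carrier assms(1)] L_tensor_index)
  then show ?thesis using tensor_apply_bound[OF L_entry_row_sum assms(2)] by simp
qed

section \<open>Rounding errors of the lossy transform\<close>

text \<open>The variables \<open>s\<close>, \<open>t\<close>, \<open>a1\<close>, \<open>a4\<close>,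
  \<open>g\<close>, \<open>h\<close> are the results of the six halvings, each too small by an
  amount in [0, 1/2]. These amounts enter the outputs linearly; the worst case is the second output,
  with error at most 23/16. The common bound 7/4 is the constant of \<open>k_L\<close>.\<close>

lemma lifting_rounding_error:
  fixes v0 v1 v2 v3 s t a1 a4 g h :: real
  assumes "2 * s \<le> v0 + v3" "v0 + v3 \<le> 2 * s + 1"
    and "2 * t \<le> v2 + v1" "v2 + v1 \<le> 2 * t + 1"
    and "2 * a1 \<le> s + t" "s + t \<le> 2 * a1 + 1"
    and "2 * a4 \<le> v3 - s + (v1 - t)" "v3 - s + (v1 - t) \<le> 2 * a4 + 1"
    and "2 * g \<le> v1 - t - a4" "v1 - t - a4 \<le> 2 * g + 1"
    and "2 * h \<le> a4 + g" "a4 + g \<le> 2 * h + 1"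
  shows "\<bar>a1 - (4 / 16 * v0 + 4 / 16 * v1 + 4 / 16 * v2 + 4 / 16 * v3)\<bar> \<le> 7 / 4"
    and "\<bar>v1 - t - a4 - h - (5 / 16 * v0 + 1 / 16 * v1 + -1 / 16 * v2 + -5 / 16 * v3)\<bar> \<le> 7 / 4"
    and "\<bar>t - a1 - (-4 / 16 * v0 + 4 / 16 * v1 + 4 / 16 * v2 + -4 / 16 * v3)\<bar> \<le> 7 / 4"
    and "\<bar>a4 + g - (-2 / 16 * v0 + 6 / 16 * v1 + -6 / 16 * v2 + 2 / 16 * v3)\<bar> \<le> 7 / 4"
  unfolding abs_le_iff by (intro conjI; use assms in argo)+

lemma L_lossy_error:
  assumes "a < 4"
  shows "\<bar>of_int (L_lossy v $ a) - (\<Sum>c<4. L_entry a c * of_int (v $ c))\<bar> \<le> 7 / 4"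
proof -
  define r where "r = (\<lambda>a::int. a div 2)"
  have r: "2 * real_of_int (r x) \<le> of_int x" "of_int x \<le> 2 * real_of_int (r x) + 1" for x
    unfolding r_def by linarith+
  \<comment> \<open>The intermediate values in the order of the assignments; \<open>a2\<close> and
    \<open>b4\<close> are the second and fourth components just before the last one.\<close>
  define s where "s = r (v $ 0 + v $ 3)"
  define t where "t = r (v $ 2 + v $ 1)"
  define a1 where "a1 = r (s + t)"
  define a4 where "a4 = r (v $ 3 - s + (v $ 1 - t))"
  define a2 where "a2 = v $ 1 - t - a4"
  define b4 where "b4 = a4 + r a2"
  have "L_lossy v = vec_of_list [a1, a2 - r b4, t - a1, b4]"
    by (simp add: L_lossy_def Let_def r_def s_def t_def a1_def a4_def a2_def b4_def)
  then have idx: "L_lossy v $ 0 = a1" "L_lossy v $ 1 = a2 - r b4" "L_lossy v $ 2 = t - a1" "L_lossy v $ 3 = b4"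
    by (simp_all add: numeral_eq_Suc)
  note errors = lifting_rounding_error[OF r[of "v $ 0 + v $ 3", folded s_def, unfolded of_int_add]
      r[of "v $ 2 + v $ 1", folded t_def, unfolded of_int_add] r[of "s + t", folded a1_def, unfolded of_int_add]
      r[of "v $ 3 - s + (v $ 1 - t)", folded a4_def, unfolded of_int_add of_int_diff]
      r[of a2, unfolded a2_def of_int_diff, folded a2_def]
      r[of b4, unfolded b4_def of_int_add a2_def of_int_diff, folded a2_def b4_def]]
  have sum: "(\<Sum>c<4. L_entry a c * of_int (v $ c)) = L_entry a 0 * v $ 0 + L_entry a 1 * v $ 1
      + L_entry a 2 * v $ 2 + L_entry a 3 * v $ 3"
    by (simp add: lessThan_4)
  show ?thesis
    using less_4_cases[OF assms]
  proof (elim disjE)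
    assume "a = 0"
    then show ?thesis unfolding sum using errors(1) idx(1) by (simp add: L_entry_def)
  next
    assume "a = 1"
    then show ?thesis unfolding sum using errors(2) idx(2) by (simp add: L_entry_def a2_def)
  next
    assume "a = 2"
    then show ?thesis unfolding sum using errors(3) idx(3) by (simp add: L_entry_def)
  next
    assume "a = 3"
    then show ?thesis unfolding sum using errors(4) idx(4) by (simp add: L_entry_def b4_def)
  qed
qed

lemma dim_fold_L_lossy_dir: "dim_vec (fold L_lossy_dir ds v) = dim_vec v"
  by (induction ds arbitrary: v) (simp_all add: L_lossy_dir_def)

text \<open>Factors of the exact transform along the directions in \<open>S\<close> only: the
  reference for a partially processed array.\<close>

definition dirs_entry :: "nat set \<Rightarrow> nat \<Rightarrow> nat \<Rightarrow> nat \<Rightarrow> real" where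
  "dirs_entry S m = (if m \<in> S then L_entry else delta)"

lemma dirs_entry_row_sum: "a < 4 \<Longrightarrow> (\<Sum>c<4. \<bar>dirs_entry S m a c\<bar>) \<le> 1"
  using L_entry_row_sum[of a] by (simp add: dirs_entry_def delta_def)

text \<open>Since \<open>m\<close> is not in \<open>S\<close>, at most one of the two factors in
  each direction is L and the other is the identity.\<close>

lemma tensor_dirs_insert:
  assumes "m \<notin> S"
  shows "(\<Sum>k<4 ^ d. tensor d (dirs_entry {m}) i k * tensor d (dirs_entry S) k j)
       = tensor d (dirs_entry (insert m S)) i j"
  unfolding tensor_mult
  by (rule tensor_cong) (use assms in \<open>auto simp: dirs_entry_def delta_def\<close>)

text \<open>Since $\|L\|_\infty \le 1$, the rounding errors of the individual directions just add up.\<close>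
lemma L_lossy_tensor_error_aux:
  assumes "dim_vec v = 4 ^ d" and "distinct ds" and "set ds \<subseteq> {..<d}" and "i < 4 ^ d"
  shows "\<bar>of_int (fold L_lossy_dir ds v $ i) - (\<Sum>j<4 ^ d. tensor d (dirs_entry (set ds)) i j * of_int (v $ j))\<bar>
       \<le> 7 / 4 * length ds"
  using assms(2-)
\<comment> \<open>\<open>fold\<close> processes the last entry of the list last, so the induction
  peels off that end.\<close>
proof (induction ds arbitrary: i rule: rev_induct)
  case Nil
  have "dirs_entry {} = (\<lambda>_. delta)" by (simp add: dirs_entry_def fun_eq_iff)
  with Nil show ?case by (simp add: tensor_delta)
next
  case (snoc m ds)
  define u where "u = fold L_lossy_dir ds v"
  \<comment> \<open>\<open>u\<close> is the rounded array before direction \<open>m\<close>, and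
    \<open>w\<close> its exact counterpart.\<close>
  define w where "w k = (\<Sum>j<4 ^ d. tensor d (dirs_entry (set ds)) k j * of_int (v $ j))" for k
  have m: "m < d" "m \<notin> set ds" using snoc.prems by auto
  have dim: "dim_vec u = 4 ^ d" using assms(1) by (simp add: u_def dim_fold_L_lossy_dir)
  have IH: "\<bar>of_int (u $ k) - w k\<bar> \<le> 7 / 4 * length ds" if "k < 4 ^ d" for k
    unfolding u_def w_def using snoc.IH[of k] that snoc.prems by auto
  have single: "tensor d (dirs_entry {m}) = tensor d (\<lambda>m'. if m' = m then L_entry else delta)"
    by (intro arg_cong[of _ _ "tensor d"] ext) (simp add: dirs_entry_def)
  let ?line = "vec 4 (\<lambda>j. u $ line_index m i j)"
  have "(\<Sum>k<4 ^ d. tensor d (dirs_entry {m}) i k * of_int (u $ k))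
      = (\<Sum>c<4. L_entry (coord m i) c * of_int (?line $ c))"
    unfolding single using tensor_single[OF m(1) snoc.prems(3)] by (auto intro!: sum.cong)
  moreover have "fold L_lossy_dir (ds @ [m]) v $ i = L_lossy ?line $ coord m i"
    using dim snoc.prems(3) by (simp add: u_def[symmetric] L_lossy_dir_def)
  \<comment> \<open>The error splits in three: 1 is the fresh rounding in direction
    \<open>m\<close>, 2 the earlier error carried through an exact map of norm at most 1, and 3
    composes the exact transforms.\<close>
  ultimately have 1: "\<bar>of_int (fold L_lossy_dir (ds @ [m]) v $ i)
      - (\<Sum>k<4 ^ d. tensor d (dirs_entry {m}) i k * of_int (u $ k))\<bar> \<le> 7 / 4"
    using L_lossy_error[OF coord_less, of ?line m i] by simp
  have "\<bar>\<Sum>k<4 ^ d. tensor d (dirs_entry {m}) i k * (of_int (u $ k) - w k)\<bar> \<le> 1 ^ d * (7 / 4 * length ds)"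
    by (rule tensor_apply_bound[OF dirs_entry_row_sum IH])
  then have 2: "\<bar>(\<Sum>k<4 ^ d. tensor d (dirs_entry {m}) i k * of_int (u $ k))
      - (\<Sum>k<4 ^ d. tensor d (dirs_entry {m}) i k * w k)\<bar> \<le> 7 / 4 * length ds"
    by (simp add: sum_subtractf[symmetric] right_diff_distrib)
  have "(\<Sum>k<4 ^ d. tensor d (dirs_entry {m}) i k * w k)
      = (\<Sum>k<4 ^ d. \<Sum>j<4 ^ d. tensor d (dirs_entry {m}) i k * tensor d (dirs_entry (set ds)) k j * of_int (v $ j))"
    by (simp add: w_def sum_distrib_left mult.assoc)
  also have "\<dots> = (\<Sum>j<4 ^ d. tensor d (dirs_entry (set (ds @ [m]))) i j * of_int (v $ j))"
    by (subst sum.swap) (simp add: sum_distrib_right[symmetric] tensor_dirs_insert[OF m(2)])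
  finally have 3: "(\<Sum>k<4 ^ d. tensor d (dirs_entry {m}) i k * w k)
      = (\<Sum>j<4 ^ d. tensor d (dirs_entry (set (ds @ [m]))) i j * of_int (v $ j))" .
  have "real (length (ds @ [m])) = real (length ds) + 1" by simp
  with 1 2 3 show ?case by linarith
qed

text \<open>The order of the directions influences the rounded result, but the exact transform
  depends only on their set, and there are d of them.\<close>

lemma L_lossy_tensor_error:
  assumes "v \<in> carrier_vec (4 ^ d)" and "distinct dirs" and "set dirs = {..<d}" and "i < 4 ^ d"
  shows "\<bar>of_int (L_lossy_tensor dirs v $ i) - (L_tensor d *\<^sub>v map_vec of_int v) $ i\<bar> \<le> 7 / 4 * d"
proof -
  have "tensor d (dirs_entry {..<d}) i j = tensor d (\<lambda>_. L_entry) i j" for j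
    by (rule tensor_cong) (simp add: dirs_entry_def)
  then have "(L_tensor d *\<^sub>v map_vec of_int v) $ i
      = (\<Sum>j<4 ^ d. tensor d (dirs_entry (set dirs)) i j * of_int (v $ j))"
    using assms(1,3,4)
    by (simp add: mult_mat_vec_index_sum[OF L_tensor_carrier, of "map_vec of_int v" d i] L_tensor_index)
  moreover have "length dirs = d" using distinct_card[OF assms(2)] assms(3) by simp
  ultimately show ?thesis
    using L_lossy_tensor_error_aux[of v d dirs i] assms by (simp add: L_lossy_tensor_def)
qed

section \<open>The error bound\<close>

lemma abs_le_inf_norm: "i < dim_vec v \<Longrightarrow> \<bar>v $ i\<bar> \<le> inf_norm v"
  unfolding inf_norm_def by (rule Max_ge) auto

lemma inf_norm_leI:
  assumes "dim_vec v > 0" and "\<And>i. i < dim_vec v \<Longrightarrow> \<bar>v $ i\<bar> \<le> B"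
  shows "inf_norm v \<le> B"
  unfolding inf_norm_def using assms by (subst Max_le_iff) auto

text \<open>\<open>e_max\<close> is attained at some nonzero component, whose leading bit bounds it
  from below.\<close>

lemma power_e_max_le_inf_norm:
  assumes "sbin_choice rB" and "v \<noteq> 0\<^sub>v (dim_vec v)"
  shows "2 powi (e_max rB v) \<le> inf_norm v"
proof -
  let ?I = "{i. i < dim_vec v \<and> v $ i \<noteq> 0}"
  have "?I \<noteq> {}" using assms(2) by (auto simp: vec_eq_iff)
  then have "e_max rB v \<in> (\<lambda>i. top_bit (snd (rB (v $ i)))) ` ?I"
    unfolding e_max_def by (intro Max_in) auto
  then obtain i where i: "i < dim_vec v" "v $ i \<noteq> 0" "e_max rB v = top_bit (snd (rB (v $ i)))"
    by auto
  have "2 powi (e_max rB v) \<le> \<bar>v $ i\<bar>"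
    using sbin_rep_nonzero_top_bit(2)[of "rB (v $ i)" "v $ i"] assms(1) i by (auto simp: sbin_choice_def)
  also have "\<dots> \<le> inf_norm v" by (rule abs_le_inf_norm[OF i(1)])
  finally show ?thesis .
qed

text \<open>Lets the linear accumulation 7/4 d be absorbed into \<open>k_L\<close>.\<close>

lemma of_nat_le_pow2_minus_1: "real d \<le> 2 ^ d - 1"
proof (induction d)
  case (Suc d)
  have "(1::real) \<le> 2 ^ d" by simp
  with Suc show ?case by simp
qed simp

text \<open>The left side is the constant that the error analysis produces; \<open>K_beta\<close>
  arises from it by replacing d with 2^d - 1 and inserting factors that are at least 1.\<close>

lemma K_beta_ge:
  "(15 / 4) ^ d * ((1 + eps (int k)) * (8 / 3 * eps \<beta> + eps (int q) * (7 / 4 * d + 1))) + eps (int k)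
     \<le> K_beta d k q \<beta>"
proof -
  have e: "0 \<le> eps m" for m by (simp add: eps_def)
  have kL: "0 \<le> k_L d" by (simp add: k_L_def)
  have "7 / 4 * d + 1 \<le> k_L d + 1"
    using of_nat_le_pow2_minus_1[of d] by (simp add: k_L_def)
  also have "\<dots> \<le> k_L d * (1 + eps (int q)) + 1"
    using kL e[of "int q"] by (simp add: mult_le_cancel_left1)
  also have "\<dots> \<le> (1 + 8 / 3 * eps \<beta>) * (k_L d * (1 + eps (int q)) + 1)"
    using kL e[of "int q"] e[of \<beta>] by (simp add: distrib_right)
  finally have "eps (int q) * (7 / 4 * d + 1)
      \<le> eps (int q) * (1 + 8 / 3 * eps \<beta>) * (k_L d * (1 + eps (int q)) + 1)"
    using e by (simp add: mult_left_mono mult.assoc)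
  then have "(15 / 4) ^ d * ((1 + eps (int k)) * (8 / 3 * eps \<beta> + eps (int q) * (7 / 4 * d + 1)))
      \<le> (15 / 4) ^ d * ((1 + eps (int k)) * (8 / 3 * eps \<beta>
          + eps (int q) * (1 + 8 / 3 * eps \<beta>) * (k_L d * (1 + eps (int q)) + 1)))"
    using e by (intro mult_left_mono) (auto intro!: add_nonneg_nonneg)
  moreover have "1 * eps (int k) \<le> (15 / 4) ^ d * eps (int k)"
    using e by (intro mult_right_mono one_le_power) auto
  ultimately show ?thesis unfolding K_beta_def distrib_left[of "(15 / 4) ^ d"] by linarith
qed

theorem theorem5p2:
  fixes d k q :: nat and \<beta> :: int and x :: "real vec"
    and rB :: "real \<Rightarrow> sbits" and rN :: "real \<Rightarrow> bits"
    and \<pi> :: "nat \<Rightarrow> nat" and dirs :: "nat list"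
  assumes "sbin_choice rB" and "negabin_choice rN"
    and "\<pi> permutes {..<4 ^ d}"
    and "distinct dirs" and "set dirs = {..<d}"
    and "d > 0" and "k > 0" and "q > 0"
    and "x \<in> carrier_vec (4 ^ d)" and "x \<noteq> 0\<^sub>v (4 ^ d)"
    and "\<forall>i < 4 ^ d. map_vec rB x $ i \<in> B_prec rB k"
    and "0 \<le> \<beta>" and "\<beta> \<le> int q - 2 * int d + 2"
  shows "inf_norm (zfp_decompress rB \<pi> d k (zfp_ell rB q x) (zfp_compress rB rN \<pi> dirs q \<beta> x) - x)
           \<le> K_beta d k q \<beta> * inf_norm x"
proof -
  define N :: nat where "N = 4 ^ d"
  have x: "dim_vec x = N" using assms(9) by (auto simp: N_def)
  have rB: "sbin_rep (rB t) t" for t using assms(1) by (auto simp: sbin_choice_def)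
  have fB_rB: "fB (rB t) = t" for t using sbin_rep_has_sum(1)[OF rB] .
  have rN: "negabin_rep (rN t) t" for t using assms(2) by (auto simp: negabin_choice_def)
  define l where "l = zfp_ell rB q x"
  \<comment> \<open>The stages of the computation: \<open>y\<close> is the scaled block,
    \<open>Y\<close> its norm, \<open>a\<close> its integer part after truncation, \<open>z\<close>
    the lossy transform, \<open>w\<close> the decoded coefficients after bits were dropped (in the
    original order), and \<open>u\<close> the inverse transform.\<close>
  define y where "y = vec N (\<lambda>i. 2 powi (- l) * x $ i)"
  define Y where "Y = 2 powi (- l) * inf_norm x"
  define a where "a = vec N (\<lambda>i. \<lfloor>fB (C2 rB q x $ i)\<rfloor>)"
  define ar :: "real vec" where "ar = map_vec of_int a"
  define z where "z = L_lossy_tensor dirs a"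
  define w where "w = vec N (\<lambda>i. fN (trunc {i. i > int q + 1 - \<beta>} (rN (of_int (z $ i)))))"
  define u where "u = the (mat_inverse (L_tensor d)) *\<^sub>v w"

  have carriers: "y \<in> carrier_vec N" "ar \<in> carrier_vec N" "a \<in> carrier_vec N" "w \<in> carrier_vec N"
    by (auto simp: y_def ar_def a_def w_def)
  have dimz: "dim_vec z = N"
    by (simp add: z_def L_lossy_tensor_def dim_fold_L_lossy_dir a_def)
  have u: "u \<in> carrier_vec N" "L_tensor d *\<^sub>v u = w"
    using mat_inverse_L_tensor[of w d] carriers by (auto simp: u_def N_def)

  have "2 powi (e_max rB x) \<le> inf_norm x"
    by (rule power_e_max_le_inf_norm[OF assms(1)]) (use assms(10) x in \<open>simp add: N_def\<close>)
  then have "2 powi (- l) * 2 powi (e_max rB x) \<le> Y" unfolding Y_def by (intro mult_left_mono) auto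
  \<comment> \<open>The choice of \<open>l\<close> gives e_max - l = q - 1.\<close>
  then have Y: "2 powi (int q - 1) \<le> Y"
    by (simp add: l_def zfp_ell_def power_int_add[symmetric])
  have epsY: "1 \<le> eps (int q) * Y"
  proof -
    have "1 = eps (int q) * 2 powi (int q - 1)"
      by (simp add: eps_def power_int_add[symmetric])
    also have "\<dots> \<le> eps (int q) * Y" using Y by (intro mult_left_mono) (auto simp: eps_def)
    finally show ?thesis .
  qed
  have y_le: "\<bar>y $ i\<bar> \<le> Y" if "i < N" for i
    using abs_le_inf_norm[of i x] that x by (simp add: y_def Y_def abs_mult)

  have ar_err: "\<bar>(ar - y) $ i\<bar> \<le> 1" if i: "i < N" for i
  proof -
    have rep: "sbin_rep (shiftB l (rB (x $ i))) (y $ i)"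
      using sbin_rep_shiftB[OF rB] i by (simp add: y_def)
    have "C2 rB q x $ i = truncB {0..} (shiftB l (rB (x $ i)))"
      using i x by (simp add: C2_def l_def)
    then have "ar $ i = fB (truncB {0..} (shiftB l (rB (x $ i))))"
      using i fB_truncB_nonneg_int[OF rep] by (simp add: ar_def a_def)
    \<comment> \<open>With the cut at -1, the truncation bound 2 * 2^(-1) is exactly 1.\<close>
    also have "{0..} = {j. j > (-1::int)}" by auto
    finally have "ar $ i = fB (truncB {j. j > -1} (shiftB l (rB (x $ i))))" .
    then show ?thesis
      using fB_truncB_error[OF rep, of "-1"] i carriers by (simp add: power_int_minus)
  qed
  have z_err: "\<bar>of_int (z $ i) - (L_tensor d *\<^sub>v ar) $ i\<bar> \<le> 7 / 4 * d" if "i < N" for i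
    using L_lossy_tensor_error[of a d dirs i] assms(4,5) carriers that
    by (simp add: z_def ar_def N_def)
  have w_err: "\<bar>w $ i - of_int (z $ i)\<bar> \<le> 8 / 3 * eps \<beta> * Y" if "i < N" for i
  proof -
    have "\<bar>w $ i - of_int (z $ i)\<bar> \<le> 4 / 3 * 2 powi (int q + 1 - \<beta>)"
      using fN_trunc_error[OF rN] that by (simp add: w_def)
    \<comment> \<open>Here 2^(q + 1 - \<beta>) = 2 * 2^(1 - \<beta>) * 2^(q - 1), which turns 4/3
      into 8/3.\<close>
    also have "\<dots> = 8 / 3 * eps \<beta> * 2 powi (int q - 1)"
      by (simp add: eps_def power_int_diff power_int_add)
    also have "\<dots> \<le> 8 / 3 * eps \<beta> * Y" using Y by (intro mult_left_mono) (auto simp: eps_def)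
    finally show ?thesis .
  qed
  define E where "E = 8 / 3 * eps \<beta> + eps (int q) * (7 / 4 * d + 1)"
  have uy: "\<bar>(u - y) $ i\<bar> \<le> (15 / 4) ^ d * (E * Y)" if i: "i < N" for i
  \<comment> \<open>It suffices to bound L_d (u - y) = (w - z) + (z - L_d ar) + L_d (ar - y); the
    three terms are the dropped bits, the lossy transform and the truncation to integers.
    \<open>epsY\<close> then makes the absolute bounds relative.\<close>
  proof (rule L_tensor_inverse_bound)
    fix j :: nat assume "j < 4 ^ d"
    then have j: "j < N" by (simp add: N_def)
    have split: "(L_tensor d *\<^sub>v (v - y)) $ j = (L_tensor d *\<^sub>v v) $ j - (L_tensor d *\<^sub>v y) $ j"
      if "v \<in> carrier_vec N" for v
      using mult_minus_distrib_mat_vec[OF L_tensor_carrier[of d], of v y] that carriers L_tensor_carrier[of d] j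
      by (simp add: N_def)
    have "\<bar>(L_tensor d *\<^sub>v (ar - y)) $ j\<bar> \<le> 1"
      by (rule L_tensor_bound) (use ar_err carriers j in \<open>auto simp: N_def\<close>)
    moreover have "(L_tensor d *\<^sub>v (u - y)) $ j = w $ j - (L_tensor d *\<^sub>v y) $ j"
      using split[OF u(1)] u(2) by simp
    ultimately have "\<bar>(L_tensor d *\<^sub>v (u - y)) $ j\<bar> \<le> 8 / 3 * eps \<beta> * Y + (7 / 4 * d + 1)"
      using w_err[OF j] z_err[OF j] split[OF carriers(2)] by linarith
    also have "\<dots> \<le> 8 / 3 * eps \<beta> * Y + (7 / 4 * d + 1) * (eps (int q) * Y)"
      using mult_left_mono[OF epsY, of "7 / 4 * real d + 1"] by simp
    also have "\<dots> = E * Y" by (simp add: E_def algebra_simps)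
    finally show "\<bar>(L_tensor d *\<^sub>v (u - y)) $ j\<bar> \<le> E * Y" .
  qed (use u carriers i in \<open>auto simp: N_def\<close>)

  define X where "X = zfp_decompress rB \<pi> d k l (zfp_compress rB rN \<pi> dirs q \<beta> x)"
  have X_eq: "X = vec N (\<lambda>i. 2 powi l * fB (fl k (rB (u $ i))))"
  proof -
    have \<pi>: "\<pi> i < N" "inv_into UNIV \<pi> i < N" "\<pi> (inv_into UNIV \<pi> i) = i" if "i < N" for i
      using that permutes_in_image[OF assms(3)] permutes_in_image[OF permutes_inv[OF assms(3)]]
        permutes_inverses[OF assms(3)] by (auto simp: N_def)
    have c2: "map_vec floor (map_vec fB (C2 rB q x)) = a"
      by (rule eq_vecI) (use x in \<open>auto simp: a_def C2_def\<close>)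
    \<comment> \<open>The permutations cancel because dropping bits is componentwise, and the
      changes of representation preserve values.\<close>
    have d4: "map_vec fB (D4 \<pi> (D5 rB (zfp_compress rB rN \<pi> dirs q \<beta> x))) = w"
      by (rule eq_vecI)
        (use dimz \<pi> in \<open>auto simp: zfp_compress_def c2 D4_def D5_def C8_def C5_def C4_def C3_def
          z_def[symmetric] w_def fB_rB\<close>)
    show ?thesis
      by (rule eq_vecI)
        (use u in \<open>auto simp: X_def zfp_decompress_def D2_def D3_def d4 u_def[symmetric] fB_shiftB\<close>)
  qed

  have ek: "0 \<le> eps (int k)" by (simp add: eps_def)
  have "\<bar>(X - x) $ i\<bar> \<le> K_beta d k q \<beta> * inf_norm x" if i: "i < N" for i
  proof -
    let ?B = "(15 / 4) ^ d * (E * Y)"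
    have "x $ i = 2 powi l * y $ i" using i by (simp add: y_def power_int_minus)
    then have "(X - x) $ i = 2 powi l * (fB (fl k (rB (u $ i))) - y $ i)"
      using i x by (simp add: X_eq right_diff_distrib)
    then have "\<bar>(X - x) $ i\<bar> = 2 powi l * \<bar>fB (fl k (rB (u $ i))) - y $ i\<bar>"
      by (simp add: abs_mult)
    also have "\<dots> \<le> 2 powi l * (K_beta d k q \<beta> * Y)"
    proof (rule mult_left_mono)
      have uyi: "\<bar>u $ i - y $ i\<bar> \<le> ?B" using uy[OF i] i u carriers by simp
      \<comment> \<open>\<open>fl\<close> has an error relative to \<open>u\<close>, not to
        \<open>y\<close>, so the size of \<open>u\<close> is needed; this produces the factor 1 +
        \<open>eps k\<close> on the error already present and the separate summand
        \<open>eps k\<close>.\<close>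
      have "\<bar>u $ i\<bar> \<le> ?B + Y" using uyi y_le[OF i] by linarith
      then have "\<bar>fB (fl k (rB (u $ i))) - u $ i\<bar> \<le> eps (int k) * (?B + Y)"
        using order_trans[OF fB_fl_error[OF rB] mult_left_mono[OF _ ek]] by blast
      then have "\<bar>fB (fl k (rB (u $ i))) - y $ i\<bar> \<le> eps (int k) * (?B + Y) + ?B"
        using uyi by linarith
      also have "\<dots> = ((15 / 4) ^ d * ((1 + eps (int k)) * E) + eps (int k)) * Y"
        by (simp add: algebra_simps)
      also have "\<dots> \<le> K_beta d k q \<beta> * Y"
        using K_beta_ge epsY Y unfolding E_def
        by (intro mult_right_mono) (auto intro: order_trans[of _ "2 powi (int q - 1)"])
      finally show "\<bar>fB (fl k (rB (u $ i))) - y $ i\<bar> \<le> K_beta d k q \<beta> * Y" .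
    qed simp
    also have "\<dots> = K_beta d k q \<beta> * inf_norm x"
      by (simp add: Y_def power_int_minus)
    finally show ?thesis .
  qed
  then have "inf_norm (X - x) \<le> K_beta d k q \<beta> * inf_norm x"
    by (intro inf_norm_leI) (use x in \<open>auto simp: N_def\<close>)
  then show ?thesis by (simp add: X_def l_def)
qed

end
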